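(* For every integer $n\geq 0$, \[ p_2(n)=p\bigl(\tfrac{n}{2}\bigr)+\sum_{k\in\mathbb{Z}\smallsetminus\{0\}}(-1)^{k-1}\, p_2\bigl(n-k^2\bigr). \]
   Context: For a nonnegative integer $m$, $p(m)$ denotes the number of partitions of $m$ and $p_2(m)$ denotes the number of bipartitions of $m$, i.e. ordered pairs $(\lambda,\mu)$ of partitions with $|\lambda|+|\mu|=m$. By convention $p(0)=p_2(0)=1$, and $p(x)=p_2(x)=0$ whenever $x$ is not a nonnegative integer (so e.g. $p(n/2)=0$ for $n$ odd, and $p_2(n-k^2)=0$ for $k^2>n$). *)

theory Defs
  imports "HOL-Analysis.Infinite_Sum" "HOL-Library.Multiset"
begin

definition is_partition :: "nat multiset \<Rightarrow> bool" where
  "is_partition \<alpha> \<longleftrightarrow> 0 \<notin># \<alpha>"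

text \<open>The size of a partition is the sum of its parts; the multiset operation \<^const>\<open>size\<close>
  would give the number of parts instead.\<close>

definition psize :: "nat multiset \<Rightarrow> nat" where
  "psize \<alpha> = \<Sum>\<^sub># \<alpha>"

text \<open>Both counting functions take a real argument, so that \<open>n / 2\<close> and \<open>n - k\<^sup>2\<close> can be
  inserted directly.  At an argument that is not a nonnegative integer the sets below are empty,
  hence the value is 0.\<close>

definition num_partitions :: "real \<Rightarrow> nat" where
  "num_partitions x = card {\<alpha>. is_partition \<alpha> \<and> real (psize \<alpha>) = x}"

definition num_bipartitions :: "real \<Rightarrow> nat" where
  "num_bipartitions x =
     card {(\<alpha>, \<beta>). is_partition \<alpha> \<and> is_partition \<beta> \<and> real (psize \<alpha> + psize \<beta>) = x}"

text \<open>The sets being counted are finite, so \<^const>\<open>card\<close> never falls back to its default 0 on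
  infinite sets.\<close>

lemma size_le_psize: "is_partition \<alpha> \<Longrightarrow> size \<alpha> \<le> psize \<alpha>"
  unfolding is_partition_def psize_def by (induction \<alpha>) auto

lemma finite_partitions_le: "finite {\<alpha>. is_partition \<alpha> \<and> psize \<alpha> \<le> m}"
proof (rule finite_subset)
  let ?L = "{xs. set xs \<subseteq> {..m} \<and> length xs \<le> m}"
  show "{\<alpha>. is_partition \<alpha> \<and> psize \<alpha> \<le> m} \<subseteq> mset ` ?L"
  proof safe
    fix \<alpha> assume \<alpha>: "is_partition \<alpha>" "psize \<alpha> \<le> m"
    obtain xs where xs: "\<alpha> = mset xs" using ex_mset by metis
    have "length xs \<le> m"
      using size_le_psize[OF \<alpha>(1)] \<alpha>(2) unfolding xs size_mset by (rule order_trans)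
    moreover have "set xs \<subseteq> {..m}"
    proof
      fix x assume "x \<in> set xs"
      then have "x \<le> sum_list xs" by (simp add: member_le_sum_list)
      with \<alpha>(2) show "x \<in> {..m}"
        by (simp add: xs psize_def sum_mset_sum_list)
    qed
    ultimately show "\<alpha> \<in> mset ` ?L" unfolding xs by blast
  qed
  show "finite (mset ` ?L)"
    using finite_lists_length_le[of "{..m}" m] by simp
qed

lemma finite_partitions: "finite {\<alpha>. is_partition \<alpha> \<and> real (psize \<alpha>) = x}"
proof (rule finite_subset)
  show "{\<alpha>. is_partition \<alpha> \<and> real (psize \<alpha>) = x}
      \<subseteq> {\<alpha>. is_partition \<alpha> \<and> psize \<alpha> \<le> nat \<lfloor>x\<rfloor>}"
    by auto
qed (rule finite_partitions_le)

lemma finite_bipartitions: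
  "finite {(\<alpha>, \<beta>). is_partition \<alpha> \<and> is_partition \<beta> \<and> real (psize \<alpha> + psize \<beta>) = x}"
proof (rule finite_subset)
  let ?A = "{\<alpha>. is_partition \<alpha> \<and> psize \<alpha> \<le> nat \<lfloor>x\<rfloor>}"
  have "a \<le> nat \<lfloor>x\<rfloor> \<and> b \<le> nat \<lfloor>x\<rfloor>" if "real (a + b) = x" for a b
    using that by linarith
  then show "{(\<alpha>, \<beta>). is_partition \<alpha> \<and> is_partition \<beta> \<and> real (psize \<alpha> + psize \<beta>) = x}
      \<subseteq> ?A \<times> ?A"
    by blast
  show "finite (?A \<times> ?A)" by (intro finite_cartesian_product finite_partitions_le)
qed

lemma num_partitions_eq_0: "x \<notin> \<nat> \<Longrightarrow> num_partitions x = 0"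
proof -
  assume "x \<notin> \<nat>"
  then have "real a \<noteq> x" for a by auto
  then show ?thesis by (simp add: num_partitions_def)
qed

lemma num_bipartitions_eq_0: "x \<notin> \<nat> \<Longrightarrow> num_bipartitions x = 0"
proof -
  assume "x \<notin> \<nat>"
  then have "real (a + b) \<noteq> x" for a b by (metis of_nat_in_Nats)
  then show ?thesis by (simp add: num_bipartitions_def del: of_nat_add)
qed

lemma is_partition_empty: "is_partition {#}"
  by (simp add: is_partition_def)

lemma psize_eq_0_iff: "is_partition \<alpha> \<Longrightarrow> psize \<alpha> = 0 \<longleftrightarrow> \<alpha> = {#}"
  by (cases \<alpha>) (auto simp: is_partition_def psize_def)

lemma num_partitions_0: "num_partitions 0 = 1"
proof -
  have "{\<alpha>. is_partition \<alpha> \<and> real (psize \<alpha>) = 0} = {{#}}"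
    by (auto simp: psize_eq_0_iff is_partition_empty)
  then show ?thesis by (simp add: num_partitions_def)
qed

lemma num_bipartitions_0: "num_bipartitions 0 = 1"
proof -
  have "{(\<alpha>, \<beta>). is_partition \<alpha> \<and> is_partition \<beta> \<and> real (psize \<alpha> + psize \<beta>) = 0}
      = {({#}, {#})}"
    by (auto simp: psize_eq_0_iff is_partition_empty add_nonneg_eq_0_iff)
  then show ?thesis by (simp add: num_bipartitions_def)
qed

text \<open>Only finitely many \<open>k\<close> contribute to the sum over the nonzero integers, so it may be
  written as an \<^const>\<open>infsum\<close> that is in fact a finite sum.\<close>

lemma finite_support_num_bipartitions:
  "finite {k::int. num_bipartitions (real n - (of_int k)\<^sup>2) \<noteq> 0}"
proof (rule finite_subset)
  show "{k::int. num_bipartitions (real n - (of_int k)\<^sup>2) \<noteq> 0} \<subseteq> {- int n..int n}"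
  proof
    fix k :: int
    assume "k \<in> {k::int. num_bipartitions (real n - (of_int k)\<^sup>2) \<noteq> 0}"
    then have "real n - (of_int k)\<^sup>2 \<in> \<nat>" 
      using num_bipartitions_eq_0[of "real n - (of_int k)\<^sup>2"] by auto
    then obtain m where "real n - (of_int k)\<^sup>2 = real m" by (rule Nats_cases)
    then have "(of_int k :: real)\<^sup>2 \<le> real n" by linarith
    then have "of_int (k\<^sup>2) \<le> (of_int (int n) :: real)" by simp
    then have "k\<^sup>2 \<le> int n" by (simp only: of_int_le_iff)
    moreover have "\<bar>k\<bar> \<le> k\<^sup>2"
      using self_le_power[of "\<bar>k\<bar>" 2] by (cases "k = 0") auto
    ultimately show "k \<in> {- int n..int n}" by auto
  qed
qed simp

end

theory Submission
  imports Defs "HOL-Computational_Algebra.Formal_Laurent_Series"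
begin

text \<open>
  In terms of generating functions the claim is \<open>P(q)\<^sup>2 \<theta>(q) = P(q\<^sup>2)\<close> with
  \<open>\<theta>(q) = \<Sum>k\<in>\<int>. (-1)\<^sup>k q\<^bsup>k\<^sup>2\<^esup>\<close>, which is Gauss's identity
  \<open>\<theta>(q) = \<Prod>i\<ge>1. (1 - q\<^sup>i) / (1 + q\<^sup>i)\<close>.  The latter follows from a finite identity in the style
  of Shanks that holds in every commutative ring and expresses
  \<open>(\<Prod>i=1..n. 1 + q\<^sup>i) (\<Sum>k=-n..n. (-1)\<^sup>k q\<^bsup>k\<^sup>2\<^esup>)\<close> as a sum whose first term is
  \<open>\<Prod>i=1..n. 1 - q\<^sup>i\<close> and whose other terms are divisible by \<open>q\<^bsup>n+1\<^esup>\<close>.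
\<close>

section \<open>Finite form of Gauss's theta identity\<close>

definition theta_partial :: "'a::comm_ring_1 \<Rightarrow> nat \<Rightarrow> 'a" where
  "theta_partial q n = 1 + 2 * (\<Sum>j=1..n. (-1) ^ j * q ^ j\<^sup>2)"

text \<open>Induction on \<open>n\<close>: passing from \<open>n\<close> to \<open>n + 1\<close>,
  summand \<open>s\<close> minus \<open>1 + q ^ Suc n\<close> times its predecessor is a difference
  in \<open>s\<close>, so the sum telescopes. The boundary term and the new summand
  \<open>s = n + 1\<close> together supply the next term of theta.\<close>

lemma theta_partial_finite_product:
  fixes q :: "'a::comm_ring_1"
  shows "(\<Prod>i=1..n. 1 + q ^ i) * theta_partial q n =
    (\<Sum>s\<le>n. (-1) ^ s * (\<Prod>i<s. 1 + q ^ i) * (\<Prod>i\<in>{s<..n}. 1 - q ^ i) * q ^ (s * Suc n))"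
proof (induction n)
  case 0
  show ?case by (simp add: theta_partial_def)
next
  case (Suc n)
  define a where "a s = (\<Prod>i<s. 1 + q ^ i)" for s
  define D where "D s = (\<Prod>i\<in>{s<..n}. 1 - q ^ i)" for s
  define t where "t m s = (-1) ^ s * a s * (\<Prod>i\<in>{s<..m}. 1 - q ^ i) * q ^ (s * Suc m)" for m s
  \<comment> \<open>The telescoping certificate. For \<open>s\<close> at most \<open>n\<close> it is
    \<open>t n s\<close> times \<open>1 - q ^ s\<close>, with that factor absorbed into
    \<open>D (s - 1)\<close>. At \<open>s = 0\<close> the factor vanishes, whereas truncated
    subtraction would give \<open>D 0\<close>, hence the case split.\<close>
  define u where "u s = (if s = 0 then 0 else (-1) ^ s * a s * D (s - 1) * q ^ (s * Suc n))" for s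
  have D_step: "D (s - Suc 0) = (1 - q ^ s) * D s" if "s \<noteq> 0" "s \<le> n" for s
  proof -
    have "{s - Suc 0<..n} = insert s {s<..n}" using that by auto
    then show ?thesis by (simp add: D_def)
  qed
  have telescope: "t (Suc n) s - (1 + q ^ Suc n) * t n s = u (Suc s) - u s" if "s \<le> n" for s
  proof -
    have "{s<..Suc n} = insert (Suc n) {s<..n}" using that by auto
    then have "t (Suc n) s = (-1) ^ s * a s * ((1 - q ^ Suc n) * D s) * (q ^ (s * Suc n) * q ^ s)"
      by (simp add: t_def D_def power_add [symmetric] add_ac)
    moreover have "t n s = (-1) ^ s * a s * D s * q ^ (s * Suc n)"
      by (simp add: t_def D_def)
    moreover have "u (Suc s) =
        - ((-1) ^ s * (a s * (1 + q ^ s)) * D s * (q ^ Suc n * q ^ (s * Suc n)))"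
      by (simp add: u_def a_def power_add mult_ac)
    moreover have "u s = (-1) ^ s * a s * ((1 - q ^ s) * D s) * q ^ (s * Suc n)"
      using that by (cases "s = 0") (simp_all add: u_def D_step)
    ultimately show ?thesis by (simp only:) (simp add: algebra_simps)
  qed
  have "(\<Sum>s\<le>n. t (Suc n) s) - (1 + q ^ Suc n) * (\<Sum>s\<le>n. t n s) = u (Suc n)"
  proof -
    have "(\<Sum>s\<le>n. t (Suc n) s) - (1 + q ^ Suc n) * (\<Sum>s\<le>n. t n s) =
        (\<Sum>s<Suc n. u (Suc s) - u s)"
      using telescope
      by (simp add: sum_distrib_left sum_subtractf [symmetric] lessThan_Suc_atMost del: power_Suc)
    also have "\<dots> = u (Suc n)"
      by (subst sum_lessThan_telescope) (simp add: u_def)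
    finally show ?thesis .
  qed
  moreover have "u (Suc n) + t (Suc n) (Suc n) =
      2 * (\<Prod>i=1..Suc n. 1 + q ^ i) * ((-1) ^ Suc n * q ^ (Suc n)\<^sup>2)"
  proof -
    \<comment> \<open>The product \<open>a\<close> starts at \<open>i = 0\<close>, where
      \<open>1 + q ^ 0 = 2\<close>; this is the factor 2 of the theta terms.\<close>
    have "(\<Prod>i=1..Suc n. 1 + q ^ i) * 2 = a (Suc (Suc n))"
      unfolding a_def by (subst prod.lessThan_Suc_shift)
        (simp add: prod.atLeast1_atMost_eq lessThan_Suc_atMost [symmetric] mult_ac del: power_Suc)
    also have "\<dots> = a (Suc n) * (1 + q ^ Suc n)"
      by (simp add: a_def)
    finally have *: "(\<Prod>i=1..Suc n. 1 + q ^ i) * 2 = a (Suc n) * (1 + q ^ Suc n)" .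
    have "u (Suc n) + t (Suc n) (Suc n) =
        (-1) ^ Suc n * q ^ (Suc n)\<^sup>2 * (a (Suc n) * (1 + q ^ Suc n))"
    proof -
      \<comment> \<open>By this splitting of the exponent, \<open>t (Suc n) (Suc n)\<close> is
        \<open>q ^ Suc n\<close> times \<open>u (Suc n)\<close>, so their sum acquires the factor
        \<open>1 + q ^ Suc n\<close>.\<close>
      have "Suc n * Suc (Suc n) = (Suc n)\<^sup>2 + Suc n"
        by (simp add: power2_eq_square)
      then have "t (Suc n) (Suc n) = (-1) ^ Suc n * a (Suc n) * (q ^ (Suc n)\<^sup>2 * q ^ Suc n)"
        by (simp only: t_def power_add) simp
      moreover have "u (Suc n) = (-1) ^ Suc n * a (Suc n) * q ^ (Suc n)\<^sup>2"
        by (simp add: u_def D_def power2_eq_square)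
      ultimately show ?thesis by (simp only: distrib_left mult_ac mult_1_left mult_1_right)
    qed
    then show ?thesis by (simp only: * [symmetric] mult_ac)
  qed
  ultimately have "(\<Sum>s\<le>Suc n. t (Suc n) s) = (1 + q ^ Suc n) * (\<Sum>s\<le>n. t n s) +
      2 * (\<Prod>i=1..Suc n. 1 + q ^ i) * ((-1) ^ Suc n * q ^ (Suc n)\<^sup>2)"
    unfolding sum.atMost_Suc by (metis add.assoc add.commute diff_eq_eq)
  moreover have "(\<Sum>s\<le>n. t n s) = (\<Prod>i=1..n. 1 + q ^ i) * theta_partial q n"
    by (simp only: Suc.IH t_def a_def)
  moreover have "theta_partial q (Suc n) =
      theta_partial q n + 2 * ((-1) ^ Suc n * q ^ (Suc n)\<^sup>2)"
    by (simp add: theta_partial_def algebra_simps)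
  moreover have "(\<Prod>i=1..Suc n. 1 + q ^ i) = (1 + q ^ Suc n) * (\<Prod>i=1..n. 1 + q ^ i)"
    by (simp add: mult.commute)
  ultimately have "(\<Prod>i=1..Suc n. 1 + q ^ i) * theta_partial q (Suc n) = (\<Sum>s\<le>Suc n. t (Suc n) s)"
    by (simp only: algebra_simps)
  then show ?case by (simp only: t_def a_def)
qed

text \<open>A congruence modulo \<open>q ^ Suc n\<close> takes the place of the limit of infinite
  products; it suffices for reading off the coefficient of index \<open>n\<close>.\<close>

corollary theta_partial_gauss:
  fixes q :: "'a::comm_ring_1"
  shows "q ^ Suc n dvd
    (\<Prod>i=1..n. 1 + q ^ i) * theta_partial q n - (\<Prod>i=1..n. 1 - q ^ i)"
proof -
  define t where "t s =
    (-1) ^ s * (\<Prod>i<s. 1 + q ^ i) * (\<Prod>i\<in>{s<..n}. 1 - q ^ i) * q ^ (s * Suc n)" for s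
  have "(\<Prod>i=1..n. 1 + q ^ i) * theta_partial q n = t 0 + (\<Sum>s\<in>{..n} - {0}. t s)"
    by (simp only: theta_partial_finite_product t_def [symmetric]) (simp add: sum.remove)
  moreover have "t 0 = (\<Prod>i=1..n. 1 - q ^ i)"
    by (simp add: t_def flip: atLeastSucAtMost_greaterThanAtMost)
  moreover have "q ^ Suc n dvd (\<Sum>s\<in>{..n} - {0}. t s)"
  proof (rule dvd_sum)
    fix s assume "s \<in> {..n} - {0}"
    then have "Suc n \<le> s * Suc n" by (cases s) simp_all
    then show "q ^ Suc n dvd t s"
      unfolding t_def by (intro dvd_mult le_imp_power_dvd)
  qed
  ultimately show ?thesis by simp
qed

section \<open>Partitions with bounded parts\<close>

definition partitions_upto :: "nat \<Rightarrow> nat \<Rightarrow> nat multiset set" where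
  "partitions_upto k m = {\<alpha>. set_mset \<alpha> \<subseteq> {1..k} \<and> psize \<alpha> = m}"

lemma finite_partitions_upto: "finite (partitions_upto k m)"
  by (rule finite_subset [OF _ finite_partitions_le [of m]])
    (auto simp: partitions_upto_def is_partition_def)

lemma partitions_upto_0: "partitions_upto 0 m = (if m = 0 then {{#}} else {})"
  by (auto simp: partitions_upto_def psize_def)

text \<open>Either \<open>Suc k\<close> is not a part, or one copy of it can be removed, after which
  further copies may remain.\<close>

lemma partitions_upto_Suc:
  "partitions_upto (Suc k) m = partitions_upto k m \<union>
    (if Suc k \<le> m then add_mset (Suc k) ` partitions_upto (Suc k) (m - Suc k) else {})"
  (is "_ = _ \<union> ?C")
proof (intro equalityI subsetI)
  fix \<alpha> assume \<alpha>: "\<alpha> \<in> partitions_upto (Suc k) m"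
  show "\<alpha> \<in> partitions_upto k m \<union> ?C"
  proof (cases "Suc k \<in># \<alpha>")
    case True
    then obtain \<beta> where "\<alpha> = add_mset (Suc k) \<beta>" by (metis multi_member_split)
    with \<alpha> show ?thesis by (auto simp: partitions_upto_def psize_def)
  next
    case False
    with \<alpha> show ?thesis by (fastforce simp: partitions_upto_def le_Suc_eq)
  qed
qed (fastforce simp: partitions_upto_def psize_def split: if_splits)

lemma card_partitions_upto_Suc:
  "card (partitions_upto (Suc k) m) = card (partitions_upto k m) +
    (if Suc k \<le> m then card (partitions_upto (Suc k) (m - Suc k)) else 0)"
proof -
  have "card (add_mset (Suc k) ` A) = card A" for A
    by (intro card_image inj_onI) simp
  moreover have "partitions_upto k m \<inter> add_mset (Suc k) ` A = {}" for A
    by (auto simp: partitions_upto_def)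
  ultimately show ?thesis
    by (subst partitions_upto_Suc) (simp add: card_Un_disjoint finite_partitions_upto)
qed

text \<open>No part exceeds the size, so a bound \<open>k\<close> of at least \<open>m\<close>
  excludes nothing. Hence bounded parts, whose generating function is a finite product, suffice for
  the low coefficients.\<close>

lemma card_partitions_upto: "m \<le> k \<Longrightarrow> card (partitions_upto k m) = num_partitions (real m)"
proof -
  assume "m \<le> k"
  have "x \<le> psize \<alpha>" if "x \<in># \<alpha>" for x \<alpha>
    using multi_member_split [OF that] by (auto simp: psize_def)
  with \<open>m \<le> k\<close> have "partitions_upto k m = {\<alpha>. is_partition \<alpha> \<and> real (psize \<alpha>) = real m}"
    by (fastforce simp: partitions_upto_def is_partition_def Suc_le_eq intro: gr0I)
  then show ?thesis by (simp add: num_partitions_def)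
qed

section \<open>Generating functions and comparison of coefficients\<close>

unbundle fps_syntax

definition partitions_upto_fps :: "nat \<Rightarrow> real fps" where
  "partitions_upto_fps k = Abs_fps (\<lambda>m. real (card (partitions_upto k m)))"

text \<open>Euler's product for bounded parts: the recurrence for the cardinalities says that
  multiplying by \<open>1 - fps_X ^ Suc k\<close> leads from bound \<open>Suc k\<close> back to
  bound \<open>k\<close>.\<close>

lemma partitions_upto_fps_product: "partitions_upto_fps k * (\<Prod>i=1..k. 1 - fps_X ^ i) = 1"
proof (induction k)
  case 0
  show ?case
    by (simp add: partitions_upto_fps_def partitions_upto_0 fps_eq_iff)
next
  case (Suc k)
  have "partitions_upto_fps (Suc k) =
      partitions_upto_fps k + fps_X ^ Suc k * partitions_upto_fps (Suc k)"
    by (rule fps_ext)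
      (simp add: partitions_upto_fps_def card_partitions_upto_Suc [of k] fps_X_power_mult_nth
        del: power_Suc)
  then have "partitions_upto_fps (Suc k) * (1 - fps_X ^ Suc k) = partitions_upto_fps k"
    by (simp add: algebra_simps)
  moreover have "partitions_upto_fps (Suc k) * (\<Prod>i=1..Suc k. 1 - fps_X ^ i) =
      (partitions_upto_fps (Suc k) * (1 - fps_X ^ Suc k)) * (\<Prod>i=1..k. 1 - fps_X ^ i)"
    by (simp add: mult_ac del: power_Suc)
  ultimately show ?case using Suc.IH by (simp only:)
qed

lemma num_bipartitions_convolution:
  "num_bipartitions (real m) = (\<Sum>i\<le>m. num_partitions (real i) * num_partitions (real (m - i)))"
proof -
  define Q where "Q i = {\<alpha>. is_partition \<alpha> \<and> real (psize \<alpha>) = real i}" for i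
  have fin: "finite (Q i)" for i unfolding Q_def by (rule finite_partitions)
  have "{(\<alpha>, \<beta>). is_partition \<alpha> \<and> is_partition \<beta> \<and> real (psize \<alpha> + psize \<beta>) = real m} =
      (\<Union>i\<le>m. Q i \<times> Q (m - i))"
    by (auto simp: Q_def simp del: of_nat_add)
  then have "num_bipartitions (real m) = card (\<Union>i\<le>m. Q i \<times> Q (m - i))"
    by (simp add: num_bipartitions_def)
  also have "\<dots> = (\<Sum>i\<le>m. card (Q i \<times> Q (m - i)))"
    by (rule card_UN_disjoint) (auto simp: fin, auto simp: Q_def)
  also have "\<dots> = (\<Sum>i\<le>m. num_partitions (real i) * num_partitions (real (m - i)))"
    by (simp add: card_cartesian_product num_partitions_def Q_def)
  finally show ?thesis .
qed

lemma partitions_upto_fps_square_nth: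
  assumes "m \<le> k"
  shows "(partitions_upto_fps k * partitions_upto_fps k) $ m = real (num_bipartitions (real m))"
  using assms
  by (simp add: fps_mult_nth partitions_upto_fps_def num_bipartitions_convolution
      card_partitions_upto atLeast0AtMost)

text \<open>Substituting \<open>fps_X\<^sup>2\<close> turns each \<open>1 - fps_X ^ i\<close> into
  \<open>(1 - fps_X ^ i) * (1 + fps_X ^ i)\<close>. So \<open>R\<close> is inverse to
  \<open>D * E\<close>, as \<open>P\<close> is to \<open>D\<close>, and the claim becomes a multiple
  of the Gauss congruence.\<close>

lemma partitions_upto_fps_theta:
  "fps_X ^ Suc n dvd
    partitions_upto_fps n * partitions_upto_fps n * theta_partial fps_X n -
    (partitions_upto_fps n oo fps_X\<^sup>2)"
proof -
  define P where "P = partitions_upto_fps n"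
  define D :: "real fps" where "D = (\<Prod>i=1..n. 1 - fps_X ^ i)"
  define E :: "real fps" where "E = (\<Prod>i=1..n. 1 + fps_X ^ i)"
  define R where "R = P oo fps_X\<^sup>2"
  define T :: "real fps" where "T = theta_partial fps_X n"
  have PD: "P * D = 1"
    unfolding P_def D_def by (rule partitions_upto_fps_product)
  have "D oo fps_X\<^sup>2 = D * E"
  proof -
    have "D oo fps_X\<^sup>2 = (\<Prod>i=1..n. (1 - fps_X ^ i) oo fps_X\<^sup>2)"
      unfolding D_def by (rule fps_compose_prod_distrib) simp
    also have "\<dots> = (\<Prod>i=1..n. (1 - fps_X ^ i) * (1 + fps_X ^ i))"
    proof (rule prod.cong)
      fix i
      have "(fps_X ^ i :: real fps) oo fps_X\<^sup>2 = fps_X ^ i * fps_X ^ i"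
        by (subst fps_X_power_compose) (simp_all flip: power_mult power_add add: mult_2)
      then show "(1 - fps_X ^ i :: real fps) oo fps_X\<^sup>2 = (1 - fps_X ^ i) * (1 + fps_X ^ i)"
        by (simp add: fps_compose_sub_distrib algebra_simps)
    qed simp
    finally show ?thesis by (simp add: D_def E_def prod.distrib)
  qed
  then have RDE: "R * (D * E) = 1"
    using arg_cong [OF PD, of "\<lambda>f. f oo fps_X\<^sup>2"]
    by (simp add: R_def fps_compose_mult_distrib)
  \<comment> \<open>\<open>P * P\<close> is multiplied by \<open>D * E * R = 1\<close> and
    \<open>R\<close> by \<open>(P * D)\<^sup>2 = 1\<close>, which exposes the common factor
    \<open>P * P * D * R\<close>.\<close>
  have "P * P * T - R = (P * P * D * E * R) * T - (P * P * D * D * R)"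
    using RDE PD by algebra
  then have "P * P * T - R = (P * P * D * R) * (E * T - D)"
    by (simp add: algebra_simps)
  moreover have "fps_X ^ Suc n dvd E * T - D"
    unfolding D_def E_def T_def by (rule theta_partial_gauss)
  ultimately have "fps_X ^ Suc n dvd P * P * T - R"
    by (metis dvd_mult)
  then show ?thesis by (simp only: P_def R_def T_def)
qed

lemma num_bipartitions_theta_recurrence:
  "real (num_bipartitions (real n)) +
     2 * (\<Sum>j=1..n. (-1) ^ j * real (num_bipartitions (real n - (real j)\<^sup>2))) =
   real (num_partitions (real n / 2))"
proof -
  define B where "B = partitions_upto_fps n * partitions_upto_fps n"
  have nth_shift: "(B * ((-1) ^ j * fps_X ^ j\<^sup>2)) $ n =
      (-1) ^ j * real (num_bipartitions (real n - (real j)\<^sup>2))" for j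
  proof -
    have "(B * ((-1) ^ j * fps_X ^ j\<^sup>2)) $ n = (-1) ^ j * (fps_X ^ j\<^sup>2 * B) $ n"
      by (cases "even j") (simp_all add: mult.commute)
    also have "(fps_X ^ j\<^sup>2 * B) $ n = real (num_bipartitions (real n - (real j)\<^sup>2))"
    \<comment> \<open>Beyond the range, the shifted coefficient is 0 and so is the count at a
      negative argument; thus \<open>j\<close> may run up to \<open>n\<close>.\<close>
    proof (cases "n < j\<^sup>2")
      case True
      then have "real n - (real j)\<^sup>2 < 0" by (simp flip: of_nat_power)
      then have "real n - (real j)\<^sup>2 \<notin> \<nat>" by (metis Nats_cases not_less of_nat_0_le_iff)
      with True show ?thesis by (simp add: fps_X_power_mult_nth num_bipartitions_eq_0)
    next
      case False
      then have "real n - (real j)\<^sup>2 = real (n - j\<^sup>2)" by (simp add: of_nat_diff)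
      with False show ?thesis
        by (simp add: fps_X_power_mult_nth B_def partitions_upto_fps_square_nth)
    qed
    finally show ?thesis .
  qed
  have "B * theta_partial fps_X n =
      B + fps_const 2 * (\<Sum>j=1..n. B * ((-1) ^ j * fps_X ^ j\<^sup>2))"
    by (simp add: theta_partial_def sum_distrib_left algebra_simps numeral_fps_const)
  then have "(B * theta_partial fps_X n) $ n = B $ n +
      2 * (\<Sum>j=1..n. (-1) ^ j * real (num_bipartitions (real n - (real j)\<^sup>2)))"
    by (simp only: fps_add_nth fps_mult_left_const_nth fps_sum_nth nth_shift)
  moreover have "(B * theta_partial fps_X n) $ n = (partitions_upto_fps n oo fps_X\<^sup>2) $ n"
  proof -
    obtain f where "B * theta_partial fps_X n - (partitions_upto_fps n oo fps_X\<^sup>2) =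
        fps_X ^ Suc n * f"
      using partitions_upto_fps_theta [of n] unfolding B_def by (elim dvdE)
    then have "(B * theta_partial fps_X n - (partitions_upto_fps n oo fps_X\<^sup>2)) $ n = 0"
      by (simp add: fps_X_power_mult_nth del: power_Suc)
    then show ?thesis by simp
  qed
  moreover have "(partitions_upto_fps n oo fps_X\<^sup>2) $ n = real (num_partitions (real n / 2))"
  \<comment> \<open>For odd \<open>n\<close> both sides vanish: the composed series has only even
    exponents, and \<open>n / 2\<close> is not a natural number.\<close>
  proof (cases "even n")
    case True
    then have "real n / 2 = real (n div 2)" by (simp add: real_of_nat_div)
    with True show ?thesis
      by (simp add: fps_nth_compose_X_power partitions_upto_fps_def card_partitions_upto)
  next
    case False
    have "real n / 2 \<notin> \<nat>"
    proof
      assume "real n / 2 \<in> \<nat>"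
      then obtain m where "real n / 2 = real m" by (rule Nats_cases)
      then have "real n = real (2 * m)" by simp
      then have "n = 2 * m" by (simp only: of_nat_eq_iff)
      with False show False by simp
    qed
    with False show ?thesis by (simp add: fps_nth_compose_X_power num_partitions_eq_0)
  qed
  ultimately show ?thesis by (simp add: B_def partitions_upto_fps_square_nth)
qed

section \<open>Folding the sum over the nonzero integers\<close>

lemma infsum_nonzero_int_even:
  fixes f :: "int \<Rightarrow> real"
  assumes even: "\<And>k. f (- k) = f k" and zero: "\<And>k. int n < \<bar>k\<bar> \<Longrightarrow> f k = 0"
  shows "(\<Sum>\<^sub>\<infinity>k\<in>UNIV - {0}. f k) = 2 * (\<Sum>j=1..n. f (int j))"
proof -
  have pos: "sum f {1..int n} = (\<Sum>j=1..n. f (int j))"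
    by (rule sum.reindex_bij_witness [of _ int nat]) auto
  have neg: "sum f {- int n..-1} = sum f {1..int n}"
    by (rule sum.reindex_bij_witness [of _ uminus uminus]) (auto simp: even)
  \<comment> \<open>Discarding the zero terms leaves a finite index set, so no convergence argument
    arises.\<close>
  have "(\<Sum>\<^sub>\<infinity>k\<in>UNIV - {0}. f k) = (\<Sum>\<^sub>\<infinity>k\<in>{- int n..-1} \<union> {1..int n}. f k)"
    by (rule infsum_cong_neutral) (auto intro: zero)
  also have "\<dots> = sum f {- int n..-1} + sum f {1..int n}"
    by (subst infsum_finite) (auto intro: sum.union_disjoint)
  finally show ?thesis by (simp add: neg pos)
qed

theorem theorem1p1:
  fixes n :: nat
  shows "real (num_bipartitions (real n)) =
           real (num_partitions (real n / 2)) +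
           (\<Sum>\<^sub>\<infinity>k\<in>UNIV - {0::int}.
              (-1) powi (k - 1) * real (num_bipartitions (real n - (real_of_int k)\<^sup>2)))"
proof -
  define f :: "int \<Rightarrow> real" where
    "f k = (-1) powi (k - 1) * real (num_bipartitions (real n - (real_of_int k)\<^sup>2))" for k
  have "(\<Sum>\<^sub>\<infinity>k\<in>UNIV - {0}. f k) = 2 * (\<Sum>j=1..n. f (int j))"
  proof (rule infsum_nonzero_int_even)
    show "f (- k) = f k" for k
      by (simp add: f_def power_int_minus_left)
    show "f k = 0" if "int n < \<bar>k\<bar>" for k
    proof -
      \<comment> \<open>Hence \<open>\<bar>k\<bar>\<close> above \<open>n\<close> makes the argument
        \<open>n - k\<^sup>2\<close> negative, where the count is 0.\<close>
      have "\<bar>k\<bar> \<le> k\<^sup>2"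
        using self_le_power [of "\<bar>k\<bar>" 2] by (cases "k = 0") auto
      with that have "int n < k\<^sup>2" by linarith
      then have "real_of_int (int n) < real_of_int (k\<^sup>2)" by (simp only: of_int_less_iff)
      then have "real n - (real_of_int k)\<^sup>2 \<notin> \<nat>" by (auto elim!: Nats_cases)
      then show ?thesis by (simp add: f_def num_bipartitions_eq_0)
    qed
  qed
  \<comment> \<open>The exponent \<open>k - 1\<close> accounts for the minus sign, which moves the
    theta terms to the other side of the recurrence.\<close>
  moreover have "f (int j) = - ((-1) ^ j * real (num_bipartitions (real n - (real j)\<^sup>2)))" for j
    by (simp add: f_def power_int_minus_left)
  ultimately show ?thesis
    using num_bipartitions_theta_recurrence [of n] by (simp add: f_def sum_negf)
qed

end
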